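(* Let $K$ be an infinite field, $R=K[x,y,z]$, and $I=(x^a,y^b,z^c,x^\alpha y^\beta z^\gamma)$, where $0\le\alpha<a$, $0\le\beta<b$, $0\le\gamma<c$ are integers and at most one of $\alpha,\beta,\gamma$ is zero. Suppose $a+b+c+\alpha+\beta+\gamma\equiv 0\pmod 3$, put $s=\frac13(a+b+c+\alpha+\beta+\gamma)-2$, $A=s+2-a$, $B=s+2-b$, $C=s+2-c$, $M=s+2-(\alpha+\beta+\gamma)$, and assume $0\le M$, $0\le A\le\beta+\gamma$, $0\le B\le\alpha+\gamma$, $0\le C\le\alpha+\beta$. If $K$ has positive characteristic $p$ and there exists a positive integer $m$ such that $$\max\{a,b,c\}\le p^m\le s+1=\tfrac13(a+b+c+\alpha+\beta+\gamma)-1,$$ then (i) $R/I$ fails to have the weak Lefschetz property; (ii) $p$ is a prime divisor of the determinant of $Z_{a,b,c,\alpha,\beta,\gamma}$; (iii) $p$ is a prime divisor of the determinant of $N_{a,b,c,\alpha,\beta,\gamma}$.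
   Context: "$p$ is a prime divisor of the determinant" means that $p$ divides this integer (which may be $0$). $R$ is standard graded. An artinian standard graded $K$-algebra $Q$ has the weak Lefschetz property if there is a linear form $\ell\in[Q]_1$ such that for all integers $d$ the map $\times\ell:[Q]_d\to[Q]_{d+1}$ is injective or surjective. $Z_{a,b,c,\alpha,\beta,\gamma}$ is the matrix with rows indexed by the monomials $m_i$ of degree $s$ not in $I$ and columns indexed by the monomials $n_j$ of degree $s+1$ not in $I$ (both in lexicographic order; the numbers of rows and columns agree), with entry $1$ if $m_i$ divides $n_j$ and $0$ otherwise, viewed as an integer matrix. $N_{a,b,c,\alpha,\beta,\gamma}$ is the $(C+M)\times(C+M)$ integer matrix with $(i,j)$ entry $\binom{c}{A+j-i}$ if $1\le i\le C$ and $\binom{\gamma}{A+C-\beta+j-i}$ if $C+1\le i\le C+M$, where $\binom nk=0$ if $k<0$ or $k>n$ (determinant of the empty matrix is $1$). *)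

theory Defs
  imports
    "HOL-Library.Poly_Mapping"
    "HOL-Library.Numeral_Type"
    "HOL-Algebra.QuotRing"
    "HOL-Algebra.Algebraic_Closure_Type"
    "Jordan_Normal_Form.Determinant"
begin

text \<open>
  Monomials in $x, y, z$ are exponent vectors indexed by the three-element type \<open>3\<close>, with
  $x, y, z$ corresponding to \<open>0 < 1 < 2\<close>. The order of
  \<^theory>\<open>HOL-Library.Poly_Mapping\<close> compares two exponent vectors at the smallest index where
  they differ, so on monomials it is the lexicographic order with $x > y > z$.
  Multiplication on \<open>'k mpoly3\<close> is the convolution product.
\<close>

type_synonym monom3 = "3 \<Rightarrow>\<^sub>0 nat"
type_synonym 'k mpoly3 = "monom3 \<Rightarrow>\<^sub>0 'k"

definition mono :: "monom3 \<Rightarrow> 'k::field mpoly3"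
  where "mono m = Poly_Mapping.single m 1"

definition x_var :: "'k::field mpoly3"
  where "x_var = mono (Poly_Mapping.single 0 1)"

definition y_var :: "'k::field mpoly3"
  where "y_var = mono (Poly_Mapping.single 1 1)"

definition z_var :: "'k::field mpoly3"
  where "z_var = mono (Poly_Mapping.single 2 1)"

definition mdeg :: "monom3 \<Rightarrow> nat"
  where "mdeg m = (\<Sum>v\<in>UNIV. Poly_Mapping.lookup m v)"

abbreviation R_ring :: "'k::field mpoly3 ring"
  where "R_ring \<equiv> ring_of_type_algebra"

text \<open>The piece of degree \<open>d\<close> of $R$; it is \<open>{0}\<close> for negative \<open>d\<close>.\<close>

definition R_comp :: "int \<Rightarrow> 'k::field mpoly3 set"
  where "R_comp d = {f. \<forall>m \<in> Poly_Mapping.keys f. int (mdeg m) = d}"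

text \<open>The image of $[R]_d$ in $R/I$, which is $[R/I]_d$ when $I$ is homogeneous.\<close>

definition quot_comp :: "'k::field mpoly3 set \<Rightarrow> int \<Rightarrow> 'k mpoly3 set set"
  where "quot_comp I d = (\<lambda>f. I +>\<^bsub>R_ring\<^esub> f) ` R_comp d"

text \<open>
  The weak Lefschetz property of an artinian ring \<open>Q\<close> whose standard grading is \<open>d \<mapsto> Qd d\<close>.
\<close>

definition weak_lefschetz :: "('q, 'b) ring_scheme \<Rightarrow> (int \<Rightarrow> 'q set) \<Rightarrow> bool"
  where "weak_lefschetz Q Qd \<longleftrightarrow>
    (\<exists>l \<in> Qd 1. \<forall>d.
       inj_on (\<lambda>q. l \<otimes>\<^bsub>Q\<^esub> q) (Qd d) \<or> (\<lambda>q. l \<otimes>\<^bsub>Q\<^esub> q) ` Qd d = Qd (d + 1))"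

definition amaci :: "nat \<Rightarrow> nat \<Rightarrow> nat \<Rightarrow> nat \<Rightarrow> nat \<Rightarrow> nat \<Rightarrow> 'k::field mpoly3 set"
  where "amaci a b c \<alpha> \<beta> \<gamma> =
    Idl\<^bsub>R_ring\<^esub> {x_var ^ a, y_var ^ b, z_var ^ c, x_var ^ \<alpha> * y_var ^ \<beta> * z_var ^ \<gamma>}"

definition std_monoms :: "'k::field mpoly3 set \<Rightarrow> int \<Rightarrow> monom3 list"
  where "std_monoms I d = rev (sorted_list_of_set {m. int (mdeg m) = d \<and> mono m \<notin> I})"

text \<open>
  The matrix $Z$ for the ideal \<open>I\<close>, with rows in degree \<open>s\<close> and columns in degree \<open>s + 1\<close>, each
  listed from the lexicographically largest monomial down.
\<close>

definition Z_mat :: "'k::field mpoly3 set \<Rightarrow> int \<Rightarrow> int mat"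
  where "Z_mat I s =
    (let rows = std_monoms I s; cols = std_monoms I (s + 1)
     in mat (length rows) (length cols)
          (\<lambda>(i, j). if (mono (rows ! i) :: 'k mpoly3) dvd mono (cols ! j) then 1 else 0))"

definition binom_int :: "nat \<Rightarrow> int \<Rightarrow> int"
  where "binom_int n k = (if k < 0 then 0 else int (n choose nat k))"

text \<open>
  Matrix indices start at 0 here, which leaves the difference of column and row index unchanged
  and turns the row condition $i \le C$ into \<open>i < C\<close>.
\<close>

definition N_mat :: "nat \<Rightarrow> nat \<Rightarrow> nat \<Rightarrow> nat \<Rightarrow> nat \<Rightarrow> nat \<Rightarrow> int mat"
  where "N_mat a b c \<alpha> \<beta> \<gamma> =
    (let s = int (a + b + c + \<alpha> + \<beta> + \<gamma>) div 3 - 2;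
         A = s + 2 - int a;
         C = s + 2 - int c;
         M = s + 2 - int (\<alpha> + \<beta> + \<gamma>)
     in mat (nat (C + M)) (nat (C + M))
          (\<lambda>(i, j). if int i < C then binom_int c (A + int j - int i)
                    else binom_int \<gamma> (A + C - int \<beta> + int j - int i)))"

end

theory Submission
  imports Defs
begin

text \<open>
  Write $q = p^m$. Everything rests on the Frobenius identity
  $(ux + vy + wz)^q = u^q x^q + v^q y^q + w^q z^q$, whose right-hand side lies in $I$ because
  $a, b, c \le q$. So every linear form $\ell$ satisfies $\ell^q \in I$, while $q$ is small enough,
  $q \le s + 1$, for this to matter in degree $s$.

  \<^bold>\<open>Multiplication by $\ell$ is not surjective onto degree $s + 1$, and $p \mid \det N$.\<close> If the
  coefficient of $z$ in $\ell$ is nonzero, then up to a scalar $\ell = z - (ux + vy)$ with new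
  coefficients $u, v$. Eliminating $z$ shows that the cokernel of
  $\times\ell : [R/I]_s \to [R/I]_{s+1}$ is the degree $s + 1$ piece of
  $K[x,y]/(x^a, y^b, (ux+vy)^c, x^\alpha y^\beta (ux+vy)^\gamma)$. The $b - A$ monomials of degree
  $s + 1$ outside $(x^a, y^b)$ are the columns of a matrix, and the monomial multiples of the last two
  generators are its $C + M = b - A$ rows; for $u = v = 1$ this is $N$ read in $K$. The rows from
  $(ux+vy)^c$ alone are already dependent: multiplying $(ux+vy)^c$ by $(ux+vy)^{q-c}$ gives
  $u^q x^q + v^q y^q$, which vanishes modulo $(x^a, y^b)$. (If $u = v = 0$, these rows are zero.) This
  gives \<open>det_relation_mat_eq_0\<close>, and hence $p \mid \det N$. A vector in the right kernel
  of the matrix is a linear functional on $[R]_{s+1}$, nonzero, which kills $[I]_{s+1}$ and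
  $\ell [R]_s$ (\<open>ex_annihilating_form\<close>). Permuting the variables covers all
  $\ell \ne 0$.

  \<^bold>\<open>$p \mid \det Z$.\<close> For $\ell = x + y + z$, the values of that functional on the monomials outside
  $I$ form a nonzero vector in the right kernel of $Z$ over $K$
  (\<open>of_int_det_Z_mat_eq_0\<close>).

  \<^bold>\<open>Multiplication by $\ell$ is not injective on degree $s$.\<close> The last power $\ell^j \notin I$ has
  $j \le q - 1 \le s$ and is killed by $\ell$. The ring $R/I$ has no socle in degrees below $s$, so
  multiplying by suitable variables turns $\ell^j$ into a nonzero element of degree $s$ that is still
  killed by $\ell$ (\<open>ex_kernel_element\<close>). So neither alternative in the weak Lefschetz
  property holds in degree $s$.
\<close>


section \<open>The relations between powers of a linear form in two variables\<close>

text \<open>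
  Binary forms of a fixed degree are dehomogenised by putting $x = 1$, so $ux + vy$ becomes the
  polynomial \<open>[:u, v:]\<close>, and the coefficient of $y^k$ keeps its meaning.
\<close>

lemma freshmans_dream_linear_poly:
  fixes u v :: "'k::field"
  assumes "prime CHAR('k)" and q: "q = CHAR('k) ^ m"
  shows "[:u, v:] ^ q = [:u ^ q:] + monom (v ^ q) q"
proof -
  have "[:u, v:] = [:u:] + monom v 1"
    by (simp add: monom_altdef)
  then have "[:u, v:] ^ q = [:u:] ^ q + monom v 1 ^ q"
    using freshmans_dream'[of q m "[:u:]" "monom v 1"] assms by simp
  then show ?thesis
    by (simp add: poly_const_pow monom_power)
qed

text \<open>
  Multiplying by $(u + vY)^{q-c}$ completes $(u + vY)^c$ to the $q$-th power, which has no middle terms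
  by Frobenius. When $u = v = 0$ that factor may be $0$, but then $(u + vY)^c$ itself is $0$ and the
  constant $1$ serves.
\<close>

lemma ex_multiple_of_linear_power_without_middle:
  fixes u v :: "'k::field"
  assumes "prime CHAR('k)" and q: "q = CHAR('k) ^ m" and "0 < c" and "c \<le> q"
  obtains P where "P \<noteq> 0" and "degree P \<le> q - c"
    and "\<And>k. 0 < k \<Longrightarrow> k < q \<Longrightarrow> coeff (P * [:u, v:] ^ c) k = 0"
proof (cases "u = 0 \<and> v = 0")
  case True
  show ?thesis
  proof (rule that[of 1])
    show "coeff (1 * [:u, v:] ^ c) k = 0" for k
      using True \<open>0 < c\<close> by (simp add: zero_power)
  qed auto
next
  case False
  let ?P = "[:u, v:] ^ (q - c)"
  show ?thesis
  proof (rule that[of ?P])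
    show "?P \<noteq> 0" using False by (auto simp del: mult_pCons_left)
    have "degree ?P \<le> degree [:u, v:] * (q - c)" by (rule degree_power_le)
    also have "\<dots> \<le> 1 * (q - c)" by (intro mult_right_mono) auto
    finally show "degree ?P \<le> q - c" by simp
    show "coeff (?P * [:u, v:] ^ c) k = 0" if "0 < k" "k < q" for k
    proof -
      have "?P * [:u, v:] ^ c = [:u ^ q:] + monom (v ^ q) q"
        using freshmans_dream_linear_poly[OF assms(1,2)] \<open>c \<le> q\<close>
        by (simp flip: power_add)
      then show ?thesis
        using that by (simp add: coeff_pCons split: nat.split)
    qed
  qed
qed

text \<open>
  With $C = s + 2 - c$ and $M = s + 2 - (\alpha + \beta + \gamma)$, these are the degree $s+1$ multiples
  $x^{C-1-i} y^i (ux+vy)^c$, for $i < C$, and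
  $x^\alpha y^\beta (ux+vy)^\gamma x^{M-1-i'} y^{i'}$ with $i' = i - C < M$,
  dehomogenised. They span, modulo
  $(x^a, y^b)$, the degree $s + 1$ part of the ideal of the last two generators.
\<close>

definition relation_poly :: "'k::field \<Rightarrow> 'k \<Rightarrow> nat \<Rightarrow> nat \<Rightarrow> nat \<Rightarrow> nat \<Rightarrow> nat \<Rightarrow> 'k poly"
  where "relation_poly u v c \<beta> \<gamma> C i =
    (if i < C then monom 1 i * [:u, v:] ^ c else monom 1 (\<beta> + (i - C)) * [:u, v:] ^ \<gamma>)"

text \<open>
  Columns are the monomials $x^{s+1-k} y^k$ with $A \le k < A + n$. When $A = s + 2 - a$ and
  $A + n = b$ these are the ones outside $(x^a, y^b)$, so the matrix presents the cokernel of
  multiplication by a linear form.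
\<close>

definition relation_mat ::
    "'k::field \<Rightarrow> 'k \<Rightarrow> nat \<Rightarrow> nat \<Rightarrow> nat \<Rightarrow> nat \<Rightarrow> nat \<Rightarrow> nat \<Rightarrow> 'k mat"
  where "relation_mat u v c \<beta> \<gamma> A C n =
    mat n n (\<lambda>(i, j). coeff (relation_poly u v c \<beta> \<gamma> C i) (A + j))"

lemma relation_mat_carrier [simp]: "relation_mat u v c \<beta> \<gamma> A C n \<in> carrier_mat n n"
  by (simp add: relation_mat_def)

lemma poly_as_sum_of_monoms_less:
  "degree P < n \<Longrightarrow> (\<Sum>i<n. monom (coeff P i) i) = P"
  using poly_as_sum_of_monoms'[of P "n - 1"]
  by (cases n) (auto simp: lessThan_Suc_atMost)

lemma mult_eq_sum_monom_mult:
  fixes P g :: "'a::comm_semiring_1 poly"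
  assumes "degree P < n"
  shows "P * g = (\<Sum>i<n. smult (coeff P i) (monom 1 i * g))"
proof -
  have "P * g = (\<Sum>i<n. monom (coeff P i) i) * g"
    using assms by (simp add: poly_as_sum_of_monoms_less)
  also have "\<dots> = (\<Sum>i<n. smult (coeff P i) (monom 1 i) * g)"
    by (simp add: sum_distrib_right smult_monom)
  also have "\<dots> = (\<Sum>i<n. smult (coeff P i) (monom 1 i * g))"
    by simp
  finally show ?thesis .
qed

text \<open>
  The coefficients of the multiplier $P$ with $P (u + vY)^c = u^q + v^q Y^q$ are a vector in the left
  kernel: $P$ has degree below $C$, so it only combines rows of the first block, and the columns only
  see exponents strictly between $0$ and $q$.
\<close>

lemma det_relation_mat_eq_0:
  fixes u v :: "'k::field"
  assumes "prime CHAR('k)" and q: "q = CHAR('k) ^ m" and "0 < c" and "c \<le> q"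
    and "0 < A" and "A + n \<le> q" and C: "q - c < C" and "C \<le> n"
  shows "det (relation_mat u v c \<beta> \<gamma> A C n) = 0"
proof -
  obtain P where P: "P \<noteq> 0" "degree P \<le> q - c"
      and mid: "\<And>k. 0 < k \<Longrightarrow> k < q \<Longrightarrow> coeff (P * [:u, v:] ^ c) k = 0"
    using ex_multiple_of_linear_power_without_middle[OF assms(1-4)] by metis
  let ?M = "relation_mat u v c \<beta> \<gamma> A C n" and ?w = "vec n (coeff P)"
  have zero: "coeff P i = 0" if "C \<le> i" for i
    using that P C by (intro coeff_eq_0) simp
  have "?w \<noteq> 0\<^sub>v n"
  proof
    assume *: "?w = 0\<^sub>v n"
    have "lead_coeff P = ?w $ degree P" using P C \<open>C \<le> n\<close> by simp
    then show False using * P C \<open>C \<le> n\<close> by simp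
  qed
  moreover have "?M\<^sup>T *\<^sub>v ?w = 0\<^sub>v n"
  proof (rule eq_vecI)
    fix j assume j: "j < dim_vec (0\<^sub>v n :: 'k vec)"
    have "(?M\<^sup>T *\<^sub>v ?w) $ j
        = (\<Sum>i<n. coeff (relation_poly u v c \<beta> \<gamma> C i) (A + j) * coeff P i)"
      using j by (simp add: relation_mat_def scalar_prod_def atLeast0LessThan)
    also have "\<dots> = (\<Sum>i<C. coeff (relation_poly u v c \<beta> \<gamma> C i) (A + j) * coeff P i)"
      using \<open>C \<le> n\<close> zero by (intro sum.mono_neutral_right) auto
    also have "\<dots> = (\<Sum>i<C. coeff (smult (coeff P i) (monom 1 i * [:u, v:] ^ c)) (A + j))"
      by (simp add: relation_poly_def mult.commute)
    also have "\<dots> = coeff (P * [:u, v:] ^ c) (A + j)"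
      using P C by (subst mult_eq_sum_monom_mult[of P C]) (auto simp: coeff_sum)
    also have "\<dots> = 0"
      using j assms by (intro mid) auto
    finally show "(?M\<^sup>T *\<^sub>v ?w) $ j = 0\<^sub>v n $ j" using j by simp
  qed (simp add: relation_mat_def)
  ultimately have "det (?M\<^sup>T) = 0"
    using det_0_iff_vec_prod_zero[of "?M\<^sup>T" n] by (auto intro!: exI[of _ ?w])
  then show ?thesis
    by (simp add: det_transpose[of _ n])
qed

lemma of_int_binom_int:
  "(of_int (binom_int n k) :: 'k::field) = (if k < 0 then 0 else coeff ([:1, 1:] ^ n) (nat k))"
  by (cases "nat k \<le> n") (auto simp: binom_int_def coeff_linear_poly_power coeff_eq_0 degree_linear_power binomial_eq_0 not_le)

text \<open>The matrix $N$ belongs to the elimination $z = x + y$.\<close>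

lemma of_int_N_mat:
  fixes A C M s :: nat
  assumes "a + b + c + \<alpha> + \<beta> + \<gamma> = 3 * (s + 2)"
    and "A + a = s + 2" and "C + c = s + 2" and "M + \<alpha> + \<beta> + \<gamma> = s + 2"
  shows "map_mat (of_int :: int \<Rightarrow> 'k::field) (N_mat a b c \<alpha> \<beta> \<gamma>)
    = relation_mat 1 1 c \<beta> \<gamma> A C (C + M)"
proof -
  have s: "int (a + b + c + \<alpha> + \<beta> + \<gamma>) div 3 - 2 = int s" 
    unfolding assms(1) by simp
  have A: "int s + 2 - int a = int A" and C: "int s + 2 - int c = int C"
    and M: "int s + 2 - int (\<alpha> + \<beta> + \<gamma>) = int M"
    using assms by linarith+
  have nm: "nat (int C + int M) = C + M" by simp
  have shape: "N_mat a b c \<alpha> \<beta> \<gamma> = mat (C + M) (C + M)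
          (\<lambda>(i, j). if int i < int C then binom_int c (int A + int j - int i)
                    else binom_int \<gamma> (int A + int C - int \<beta> + int j - int i))"
    unfolding N_mat_def Let_def s A C M nm ..
  show ?thesis
  proof (rule eq_matI)
    fix i j
    assume "i < dim_row (relation_mat (1::'k) 1 c \<beta> \<gamma> A C (C + M))"
      and "j < dim_col (relation_mat (1::'k) 1 c \<beta> \<gamma> A C (C + M))"
    then have ij: "i < C + M" "j < C + M" by (simp_all add: relation_mat_def)
    show "map_mat of_int (N_mat a b c \<alpha> \<beta> \<gamma>) $$ (i, j)
        = relation_mat (1::'k) 1 c \<beta> \<gamma> A C (C + M) $$ (i, j)"
    proof (cases "i < C")
      case True
      have "nat (int A + int j - int i) = A + j - i" by linarith
      then show ?thesis
        using ij True
        by (auto simp: shape relation_mat_def relation_poly_def of_int_binom_int coeff_monom_mult)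
    next
      case False
      have "nat (int A + int C - int \<beta> + int j - int i) = A + j - (\<beta> + (i - C))"
        using False by linarith
      then show ?thesis
        using ij False
        by (auto simp: shape relation_mat_def relation_poly_def of_int_binom_int coeff_monom_mult)
    qed
  qed (simp_all add: shape relation_mat_def)
qed

section \<open>A functional that annihilates the ideal and the multiples of a linear form\<close>

definition in_amaci :: "nat \<Rightarrow> nat \<Rightarrow> nat \<Rightarrow> nat \<Rightarrow> nat \<Rightarrow> nat \<Rightarrow> nat \<Rightarrow> nat \<Rightarrow> nat \<Rightarrow> bool"
  where "in_amaci a b c \<alpha> \<beta> \<gamma> i j k \<longleftrightarrow>
    a \<le> i \<or> b \<le> j \<or> c \<le> k \<or> \<alpha> \<le> i \<and> \<beta> \<le> j \<and> \<gamma> \<le> k"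

text \<open>
  Here \<open>\<phi> i j k\<close> is the value at $x^i y^j z^k$ of a nonzero linear functional on $[R]_{s+1}$. It kills
  the monomials in \<open>U\<close> and all $(ux + vy + wz) n$ with $n$ a monomial of degree $s$, so it witnesses
  a nonzero cokernel.
\<close>

definition annihilates ::
    "(nat \<Rightarrow> nat \<Rightarrow> nat \<Rightarrow> bool) \<Rightarrow> nat \<Rightarrow> 'k::field \<Rightarrow> 'k \<Rightarrow> 'k \<Rightarrow> (nat \<Rightarrow> nat \<Rightarrow> nat \<Rightarrow> 'k) \<Rightarrow> bool"
  where "annihilates U s u v w \<phi> \<longleftrightarrow>
    (\<exists>i j k. i + j + k = s + 1 \<and> \<phi> i j k \<noteq> 0) \<and>
    (\<forall>i j k. i + j + k = s + 1 \<longrightarrow> U i j k \<longrightarrow> \<phi> i j k = 0) \<and>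
    (\<forall>i j k. i + j + k = s \<longrightarrow>
       u * \<phi> (Suc i) j k + v * \<phi> i (Suc j) k + w * \<phi> i j (Suc k) = 0)"

text \<open>
  A column vector for \<open>relation_mat\<close>, as a functional on binary forms. Reading only the \<open>n\<close>
  coefficients from $y^A$ on makes it vanish on $(x^a, y^b)$ when $A = s + 2 - a$ and $A + n = b$.
\<close>

definition window_form :: "nat \<Rightarrow> nat \<Rightarrow> 'k::field vec \<Rightarrow> 'k poly \<Rightarrow> 'k"
  where "window_form A n x P = (\<Sum>t<n. coeff P (A + t) * x $ t)"

lemma window_form_add: "window_form A n x (P + Q) = window_form A n x P + window_form A n x Q"
  by (simp add: window_form_def algebra_simps sum.distrib)

lemma window_form_smult: "window_form A n x (smult a P) = a * window_form A n x P"
  by (simp add: window_form_def algebra_simps sum_distrib_left)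

lemma window_form_sum: "window_form A n x (\<Sum>i\<in>S. f i) = (\<Sum>i\<in>S. window_form A n x (f i))"
  by (induction S rule: infinite_finite_induct)
     (simp_all add: window_form_add, simp_all add: window_form_def)

lemma window_form_eq_0_mult:
  assumes "\<And>i. i < d \<Longrightarrow> window_form A n x (monom 1 i * g) = 0" and "degree P < d"
  shows "window_form A n x (P * g) = 0"
  using assms by (simp add: mult_eq_sum_monom_mult[of P d] window_form_sum window_form_smult)

lemma window_form_low_degree: "degree P < A \<Longrightarrow> window_form A n x P = 0"
  unfolding window_form_def by (intro sum.neutral ballI) (simp add: coeff_eq_0)

lemma window_form_high_order: "A + n \<le> j \<Longrightarrow> window_form A n x (monom 1 j * P) = 0"
  unfolding window_form_def by (intro sum.neutral ballI) (simp add: coeff_monom_mult)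

lemma degree_monom_mult_linear_power_le: "degree (monom 1 j * [:u, v:] ^ k) \<le> j + k"
proof -
  have "degree ([:u, v:] ^ k) \<le> degree [:u, v:] * k" by (rule degree_power_le)
  also have "\<dots> \<le> 1 * k" by (intro mult_right_mono) auto
  finally show ?thesis
    using degree_mult_le[of "monom 1 j" "[:u, v:] ^ k"] degree_monom_le[of "1 :: 'a" j] by linarith
qed

text \<open>
  Eliminating $z$ by $z = u'x + v'y$ sends $x^i y^j z^k$ to the binary form $x^i y^j (u'x + v'y)^k$.
  Composing this with a functional from the right kernel of \<open>relation_mat\<close> gives \<open>\<phi>\<close>:
  compatibility with the elimination is the vanishing on multiples of the linear form, and the four
  generators of $I$ are handled by the window (for $x^a$ and $y^b$) and by the two blocks of rows (for
  $z^c$ and the mixed monomial).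
\<close>

lemma ex_annihilating_form_z:
  fixes u v w :: "'k::field"
  assumes p: "prime CHAR('k)" and q: "q = CHAR('k) ^ m"
    and total: "a + b + c + \<alpha> + \<beta> + \<gamma> = 3 * (s + 2)"
    and "a \<le> q" "b \<le> q" "c \<le> q" "q \<le> s + 1" "0 < c" and mixed: "\<alpha> + \<beta> + \<gamma> \<le> s + 2"
    and "w \<noteq> 0"
  shows "\<exists>\<phi>. annihilates (in_amaci a b c \<alpha> \<beta> \<gamma>) s u v w \<phi>"
proof -
  define u' v' where "u' = - u / w" and "v' = - v / w"
  define A C M where "A = s + 2 - a" and "C = s + 2 - c" and "M = s + 2 - (\<alpha> + \<beta> + \<gamma>)"
  let ?n = "C + M"
  have "A + a = s + 2" "C + c = s + 2" "M + (\<alpha> + \<beta> + \<gamma>) = s + 2" and A: "0 < A"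
    using assms by (simp_all add: A_def C_def M_def)
  then have b: "A + ?n = b"
    using total by (simp add: algebra_simps)
  let ?N = "relation_mat u' v' c \<beta> \<gamma> A C ?n"
  have "det ?N = 0"
    using assms b A by (intro det_relation_mat_eq_0[OF p q]) (auto simp: C_def)
  then obtain x where x: "x \<in> carrier_vec ?n" "x \<noteq> 0\<^sub>v ?n" "?N *\<^sub>v x = 0\<^sub>v ?n"
    using det_0_iff_vec_prod_zero[of ?N ?n] by auto
  let ?\<psi> = "window_form A ?n x"
  have rel: "?\<psi> (relation_poly u' v' c \<beta> \<gamma> C i) = 0" if "i < ?n" for i
  proof -
    have "(?N *\<^sub>v x) $ i = ?\<psi> (relation_poly u' v' c \<beta> \<gamma> C i)"
      using that x(1)
      by (simp add: relation_mat_def scalar_prod_def window_form_def atLeast0LessThan)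
    then show ?thesis using x(3) that by simp
  qed
  have \<psi>_c: "?\<psi> (P * [:u', v':] ^ c) = 0" if "degree P < C" for P
  proof (rule window_form_eq_0_mult[OF _ that])
    show "?\<psi> (monom 1 i * [:u', v':] ^ c) = 0" if "i < C" for i
      using rel[of i] that by (simp add: relation_poly_def)
  qed
  have \<psi>_m: "?\<psi> (P * (monom 1 \<beta> * [:u', v':] ^ \<gamma>)) = 0" if "degree P < M" for P
  proof (rule window_form_eq_0_mult[OF _ that])
    fix i assume "i < M"
    then show "?\<psi> (monom 1 i * (monom 1 \<beta> * [:u', v':] ^ \<gamma>)) = 0"
      using rel[of "C + i"]
      by (simp add: relation_poly_def mult_monom add.commute flip: mult.assoc)
  qed
  define \<phi> where "\<phi> = (\<lambda>(i::nat) j k. ?\<psi> (monom 1 j * [:u', v':] ^ k))"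
  have "annihilates (in_amaci a b c \<alpha> \<beta> \<gamma>) s u v w \<phi>"
    unfolding annihilates_def
  proof (intro conjI allI impI)
    obtain t where t: "t < ?n" "x $ t \<noteq> 0"
      using x(1,2) by (metis carrier_vecD eq_vecI index_zero_vec)
    have "\<phi> (s + 1 - (A + t)) (A + t) 0 = (\<Sum>t'<?n. (if t' = t then 1 else 0) * x $ t')"
      unfolding \<phi>_def window_form_def by (intro sum.cong) (auto simp: coeff_monom)
    also have "\<dots> = x $ t" using t by (simp add: if_distrib[of "\<lambda>y. y * _"] cong: if_cong)
    finally show "\<exists>i j k. i + j + k = s + 1 \<and> \<phi> i j k \<noteq> 0"
      using t b assms
      by (intro exI[of _ "s + 1 - (A + t)"] exI[of _ "A + t"] exI[of _ 0]) auto
  next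
    fix i j k assume deg: "i + j + k = s + 1" and "in_amaci a b c \<alpha> \<beta> \<gamma> i j k"
    then consider "a \<le> i" | "b \<le> j" | "c \<le> k" | "\<alpha> \<le> i" "\<beta> \<le> j" "\<gamma> \<le> k"
      by (auto simp: in_amaci_def)
    then show "\<phi> i j k = 0"
    proof cases
      case 1
      then have "j + k < A" using deg assms by (simp add: A_def)
      then show ?thesis unfolding \<phi>_def
        by (intro window_form_low_degree le_less_trans[OF degree_monom_mult_linear_power_le])
    next
      case 2
      then show ?thesis unfolding \<phi>_def using b by (intro window_form_high_order) simp
    next
      case 3
      have "monom 1 j * [:u', v':] ^ k = (monom 1 j * [:u', v':] ^ (k - c)) * [:u', v':] ^ c"
        using 3 by (simp only: mult.assoc power_add[symmetric]) simp
      moreover have "j + (k - c) < C" using 3 deg by (simp add: C_def)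
      ultimately show ?thesis unfolding \<phi>_def
        by (simp only: \<psi>_c le_less_trans[OF degree_monom_mult_linear_power_le])
    next
      case 4
      have "(monom 1 (j - \<beta>) * [:u', v':] ^ (k - \<gamma>)) * (monom 1 \<beta> * [:u', v':] ^ \<gamma>)
          = (monom 1 (j - \<beta>) * monom 1 \<beta>) * ([:u', v':] ^ (k - \<gamma>) * [:u', v':] ^ \<gamma>)"
        by (simp only: mult_ac)
      also have "\<dots> = monom 1 j * [:u', v':] ^ k"
        using 4 by (simp add: mult_monom flip: power_add)
      finally have "monom 1 j * [:u', v':] ^ k
          = (monom 1 (j - \<beta>) * [:u', v':] ^ (k - \<gamma>)) * (monom 1 \<beta> * [:u', v':] ^ \<gamma>)" ..
      moreover have "(j - \<beta>) + (k - \<gamma>) < M" using 4 deg by (simp add: M_def)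
      ultimately show ?thesis unfolding \<phi>_def
        by (simp only: \<psi>_m le_less_trans[OF degree_monom_mult_linear_power_le])
    qed
  next
    fix i j k assume "i + j + k = s"
    have "[:u', v':] = smult u' 1 + smult v' (monom 1 1)"
      by (simp add: monom_altdef)
    then have "monom 1 j * [:u', v':] ^ Suc k
        = monom 1 j * [:u', v':] ^ k * (smult u' 1 + smult v' (monom 1 1))"
      by (simp only: power_Suc2 mult.assoc)
    also have "\<dots> = smult u' (monom 1 j * [:u', v':] ^ k)
        + smult v' ((monom 1 j * monom 1 1) * [:u', v':] ^ k)"
      by (simp only: distrib_left mult_smult_left mult_smult_right mult_1_left mult_1_right mult_ac)
    finally have "monom 1 j * [:u', v':] ^ Suc k = smult u' (monom 1 j * [:u', v':] ^ k)
        + smult v' (monom 1 (Suc j) * [:u', v':] ^ k)"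
      by (simp only: mult_monom) simp
    then have "\<phi> i j (Suc k) = u' * \<phi> (Suc i) j k + v' * \<phi> i (Suc j) k"
      by (simp only: \<phi>_def window_form_add window_form_smult)
    then show "u * \<phi> (Suc i) j k + v * \<phi> i (Suc j) k + w * \<phi> i j (Suc k) = 0"
      using \<open>w \<noteq> 0\<close> by (simp add: u'_def v'_def field_simps)
  qed
  then show ?thesis by (intro exI[of _ \<phi>])
qed

lemma annihilates_swap_xz:
  assumes "annihilates (\<lambda>i j k. U k j i) s w v u \<phi>"
  shows "annihilates U s u v w (\<lambda>i j k. \<phi> k j i)"
proof -
  have 1: "\<exists>i j k. i + j + k = s + 1 \<and> \<phi> i j k \<noteq> 0"
    and 2: "\<And>i j k. i + j + k = s + 1 \<Longrightarrow> U k j i \<Longrightarrow> \<phi> i j k = 0"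
    and 3: "\<And>i j k. i + j + k = s \<Longrightarrow>
      w * \<phi> (Suc i) j k + v * \<phi> i (Suc j) k + u * \<phi> i j (Suc k) = 0"
    using assms unfolding annihilates_def by blast+
  obtain i j k where "i + j + k = s + 1" "\<phi> i j k \<noteq> 0" using 1 by blast
  then have "\<exists>i j k. i + j + k = s + 1 \<and> \<phi> k j i \<noteq> 0"
    by (intro exI[of _ k] exI[of _ j] exI[of _ i]) simp
  moreover have "\<phi> k j i = 0" if "i + j + k = s + 1" "U i j k" for i j k
    using that by (intro 2) simp_all
  moreover have "u * \<phi> k j (Suc i) + v * \<phi> k (Suc j) i + w * \<phi> (Suc k) j i = 0"
    if "i + j + k = s" for i j k
    using 3[of k j i] that by (simp add: algebra_simps)
  ultimately show ?thesis unfolding annihilates_def by blast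
qed

lemma annihilates_swap_yz:
  assumes "annihilates (\<lambda>i j k. U i k j) s u w v \<phi>"
  shows "annihilates U s u v w (\<lambda>i j k. \<phi> i k j)"
proof -
  have 1: "\<exists>i j k. i + j + k = s + 1 \<and> \<phi> i j k \<noteq> 0"
    and 2: "\<And>i j k. i + j + k = s + 1 \<Longrightarrow> U i k j \<Longrightarrow> \<phi> i j k = 0"
    and 3: "\<And>i j k. i + j + k = s \<Longrightarrow>
      u * \<phi> (Suc i) j k + w * \<phi> i (Suc j) k + v * \<phi> i j (Suc k) = 0"
    using assms unfolding annihilates_def by blast+
  obtain i j k where "i + j + k = s + 1" "\<phi> i j k \<noteq> 0" using 1 by blast
  then have "\<exists>i j k. i + j + k = s + 1 \<and> \<phi> i k j \<noteq> 0"
    by (intro exI[of _ i] exI[of _ k] exI[of _ j]) simp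
  moreover have "\<phi> i k j = 0" if "i + j + k = s + 1" "U i j k" for i j k
    using that by (intro 2) simp_all
  moreover have "u * \<phi> (Suc i) k j + v * \<phi> i k (Suc j) + w * \<phi> i (Suc k) j = 0"
    if "i + j + k = s" for i j k
    using 3[of i k j] that by (simp add: algebra_simps)
  ultimately show ?thesis unfolding annihilates_def by blast
qed

text \<open>
  The hypotheses are symmetric in the three variables, so any variable with a nonzero coefficient can
  be eliminated. For the zero form it is enough to annihilate $I$, and a functional for another linear
  form does that.
\<close>

lemma ex_annihilating_form:
  fixes u v w :: "'k::field"
  assumes p: "prime CHAR('k)" and q: "q = CHAR('k) ^ m"
    and total: "a + b + c + \<alpha> + \<beta> + \<gamma> = 3 * (s + 2)"
    and le: "a \<le> q" "b \<le> q" "c \<le> q" "q \<le> s + 1" and pos: "0 < a" "0 < b" "0 < c"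
    and mixed: "\<alpha> + \<beta> + \<gamma> \<le> s + 2"
  shows "\<exists>\<phi>. annihilates (in_amaci a b c \<alpha> \<beta> \<gamma>) s u v w \<phi>"
proof -
  consider "w \<noteq> 0" | "u \<noteq> 0" | "v \<noteq> 0" | "u = 0" "v = 0" "w = 0" by blast
  then show ?thesis
  proof cases
    case 1
    show ?thesis
      by (rule ex_annihilating_form_z[OF p q total le pos(3) mixed 1])
  next
    case 2
    have sym: "in_amaci c b a \<gamma> \<beta> \<alpha> = (\<lambda>i j k. in_amaci a b c \<alpha> \<beta> \<gamma> k j i)"
      by (auto simp: in_amaci_def fun_eq_iff)
    have "c + b + a + \<gamma> + \<beta> + \<alpha> = 3 * (s + 2)" "\<gamma> + \<beta> + \<alpha> \<le> s + 2"
      using total mixed by (simp_all only: add_ac)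
    then have "\<exists>\<phi>. annihilates (in_amaci c b a \<gamma> \<beta> \<alpha>) s w v u \<phi>"
      by (intro ex_annihilating_form_z[OF p q _ le(3,2,1,4) pos(1) _ 2])
    then obtain \<phi> where "annihilates (in_amaci c b a \<gamma> \<beta> \<alpha>) s w v u \<phi>" by blast
    then have "annihilates (in_amaci a b c \<alpha> \<beta> \<gamma>) s u v w (\<lambda>i j k. \<phi> k j i)"
      unfolding sym by (rule annihilates_swap_xz)
    then show ?thesis by (intro exI[of _ "\<lambda>i j k. \<phi> k j i"])
  next
    case 3
    have sym: "in_amaci a c b \<alpha> \<gamma> \<beta> = (\<lambda>i j k. in_amaci a b c \<alpha> \<beta> \<gamma> i k j)"
      by (auto simp: in_amaci_def fun_eq_iff)
    have "a + c + b + \<alpha> + \<gamma> + \<beta> = 3 * (s + 2)" "\<alpha> + \<gamma> + \<beta> \<le> s + 2"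
      using total mixed by (simp_all only: add_ac)
    then have "\<exists>\<phi>. annihilates (in_amaci a c b \<alpha> \<gamma> \<beta>) s u w v \<phi>"
      by (intro ex_annihilating_form_z[OF p q _ le(1,3,2,4) pos(2) _ 3])
    then obtain \<phi> where "annihilates (in_amaci a c b \<alpha> \<gamma> \<beta>) s u w v \<phi>" by blast
    then have "annihilates (in_amaci a b c \<alpha> \<beta> \<gamma>) s u v w (\<lambda>i j k. \<phi> i k j)"
      unfolding sym by (rule annihilates_swap_yz)
    then show ?thesis by (intro exI[of _ "\<lambda>i j k. \<phi> i k j"])
  next
    case 4
    obtain \<phi> where "annihilates (in_amaci a b c \<alpha> \<beta> \<gamma>) s 0 0 (1::'k) \<phi>"
      using ex_annihilating_form_z[OF p q total, OF le pos(3) mixed, of 1 0 0] by auto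
    then have "annihilates (in_amaci a b c \<alpha> \<beta> \<gamma>) s u v w \<phi>"
      using 4 by (simp add: annihilates_def)
    then show ?thesis by (intro exI[of _ \<phi>])
  qed
qed

section \<open>Monomial ideals in three variables\<close>

lemma UNIV_3: "(UNIV :: 3 set) = {0, 1, 2}"
proof -
  have "card {0, 1, 2 :: 3} = CARD(3)" by simp
  then show ?thesis by (metis card_subset_eq finite top_greatest)
qed

lemma all_3: "(\<forall>v::3. P v) \<longleftrightarrow> P 0 \<and> P 1 \<and> P 2"
  using UNIV_3 by (metis UNIV_I empty_iff insert_iff)

definition expo :: "nat \<Rightarrow> nat \<Rightarrow> nat \<Rightarrow> monom3"
  where "expo i j k = Poly_Mapping.single 0 i + Poly_Mapping.single 1 j + Poly_Mapping.single 2 k"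

lemma lookup_expo [simp]:
  "Poly_Mapping.lookup (expo i j k) 0 = i"
  "Poly_Mapping.lookup (expo i j k) 1 = j"
  "Poly_Mapping.lookup (expo i j k) 2 = k"
  by (simp_all add: expo_def lookup_add lookup_single)

lemma monom3_eq_iff:
  "(m::monom3) = n \<longleftrightarrow> Poly_Mapping.lookup m 0 = Poly_Mapping.lookup n 0
    \<and> Poly_Mapping.lookup m 1 = Poly_Mapping.lookup n 1
    \<and> Poly_Mapping.lookup m 2 = Poly_Mapping.lookup n 2"
  by (auto simp: poly_mapping_eq_iff fun_eq_iff all_3)

lemma expo_cases [cases type]:
  obtains i j k where "(m::monom3) = expo i j k"
  by (metis monom3_eq_iff lookup_expo)

lemma expo_eq_iff [simp]: "expo i j k = expo i' j' k' \<longleftrightarrow> i = i' \<and> j = j' \<and> k = k'"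
  by (simp add: monom3_eq_iff)

lemma expo_add [simp]: "expo i j k + expo i' j' k' = expo (i + i') (j + j') (k + k')"
  by (simp add: monom3_eq_iff lookup_add)

lemma expo_0: "expo 0 0 0 = 0"
  by (simp add: monom3_eq_iff)

lemma mdeg_expo [simp]: "mdeg (expo i j k) = i + j + k"
  unfolding mdeg_def UNIV_3 by simp

lemma mdeg_add: "mdeg (m + n) = mdeg m + mdeg n"
  by (simp add: mdeg_def lookup_add sum.distrib)

lemma finite_mdeg_eq: "finite {m. mdeg m = d}"
proof (rule finite_subset)
  show "{m. mdeg m = d} \<subseteq> (\<lambda>(i, j, k). expo i j k) ` ({..d} \<times> {..d} \<times> {..d})"
  proof
    fix m assume "m \<in> {m. mdeg m = d}"
    then show "m \<in> (\<lambda>(i, j, k). expo i j k) ` ({..d} \<times> {..d} \<times> {..d})"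
      by (cases m) (force simp: image_iff)
  qed
qed simp

lemma single_power:
  "Poly_Mapping.single (expo i j k) (u::'k::field) ^ n
    = Poly_Mapping.single (expo (n * i) (n * j) (n * k)) (u ^ n)"
  by (induction n) (simp_all add: expo_0 mult_single)

lemma sum_single_keys:
  fixes f :: "'a \<Rightarrow>\<^sub>0 'b::comm_monoid_add"
  shows
  "(\<Sum>m\<in>Poly_Mapping.keys f. Poly_Mapping.single m (Poly_Mapping.lookup f m)) = f"
  by (rule poly_mapping_eqI) (simp add: lookup_sum lookup_single when_def in_keys_iff)

lemma poly_mapping_single_induct [case_names zero add single]:
  fixes f :: "'a \<Rightarrow>\<^sub>0 'b::comm_monoid_add"
  assumes "P 0" and "\<And>f g. P f \<Longrightarrow> P g \<Longrightarrow> P (f + g)"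
    and "\<And>m. m \<in> Poly_Mapping.keys f \<Longrightarrow> P (Poly_Mapping.single m (Poly_Mapping.lookup f m))"
  shows "P f"
proof -
  have "P (\<Sum>m\<in>S. Poly_Mapping.single m (Poly_Mapping.lookup f m))"
    if "finite S" "S \<subseteq> Poly_Mapping.keys f" for S
    using that by (induction S) (auto intro: assms)
  then show ?thesis
    by (metis finite_keys order_refl sum_single_keys)
qed

lemma R_ring_simps [simp]:
  "carrier R_ring = UNIV" "f \<otimes>\<^bsub>R_ring\<^esub> g = f * g" "f \<oplus>\<^bsub>R_ring\<^esub> g = f + g"
  "\<zero>\<^bsub>R_ring\<^esub> = 0" "\<one>\<^bsub>R_ring\<^esub> = 1"
  by (simp_all add: ring_of_type_algebra_def)

lemma ring_R_ring: "ring (R_ring :: 'k::field mpoly3 ring)"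
  by (rule ring_from_type_algebra)

lemma R_ring_a_inv: "\<ominus>\<^bsub>R_ring\<^esub> f = - (f :: 'k::field mpoly3)"
proof -
  interpret ring "R_ring :: 'k mpoly3 ring" by (rule ring_R_ring)
  show ?thesis by (rule minus_equality) simp_all
qed

definition monom_span :: "monom3 set \<Rightarrow> 'k::field mpoly3 set"
  where "monom_span S = {f. Poly_Mapping.keys f \<subseteq> S}"

lemma ideal_monom_span:
  assumes "\<And>m n. m \<in> S \<Longrightarrow> m + n \<in> S"
  shows "ideal (monom_span S :: 'k::field mpoly3 set) R_ring"
proof (rule idealI[OF ring_R_ring])
  interpret ring "R_ring :: 'k mpoly3 ring" by (rule ring_R_ring)
  show "subgroup (monom_span S :: 'k mpoly3 set) (add_monoid R_ring)"
  proof (rule add.subgroupI)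
    fix f g :: "'k mpoly3"
    assume "f \<in> monom_span S" "g \<in> monom_span S"
    then show "f \<oplus>\<^bsub>R_ring\<^esub> g \<in> monom_span S"
      using keys_add[of f g] by (auto simp: monom_span_def)
  next
    fix f :: "'k mpoly3"
    assume "f \<in> monom_span S"
    then have "- f \<in> monom_span S" by (auto simp: monom_span_def in_keys_iff)
    then show "\<ominus>\<^bsub>R_ring\<^esub> f \<in> monom_span S"
      by (simp add: R_ring_a_inv)
  qed (auto simp: monom_span_def intro: exI[of _ 0])
next
  fix f g :: "'k mpoly3"
  assume f: "f \<in> monom_span S"
  have "f * g \<in> monom_span S"
    unfolding monom_span_def
  proof safe
    fix k assume "k \<in> Poly_Mapping.keys (f * g)"
    then obtain m n where "k = m + n" "m \<in> Poly_Mapping.keys f"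
      using keys_mult[of f g] by blast
    then show "k \<in> S" using f assms by (auto simp: monom_span_def)
  qed
  then show "g \<otimes>\<^bsub>R_ring\<^esub> f \<in> monom_span S" "f \<otimes>\<^bsub>R_ring\<^esub> g \<in> monom_span S"
    by (simp_all add: mult.commute[of g f])
qed

text \<open>
  This turns membership in $I$ into a condition on each monomial of the support separately.
\<close>

lemma genideal_monos:
  "Idl\<^bsub>R_ring\<^esub> (mono ` G) = (monom_span {g + n | g n. g \<in> G} :: 'k::field mpoly3 set)"
proof -
  interpret ring "R_ring :: 'k mpoly3 ring" by (rule ring_R_ring)
  let ?J = "Idl\<^bsub>R_ring\<^esub> (mono ` G) :: 'k mpoly3 set"
  interpret J: ideal ?J R_ring by (rule genideal_ideal) simp
  show ?thesis
  proof
    show "?J \<subseteq> monom_span {g + n | g n. g \<in> G}"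
    proof (rule genideal_minimal)
      show "ideal (monom_span {g + n | g n. g \<in> G} :: 'k mpoly3 set) R_ring"
        by (rule ideal_monom_span) (blast intro: add.assoc)
      show "mono ` G \<subseteq> (monom_span {g + n | g n. g \<in> G} :: 'k mpoly3 set)"
        by (auto simp: monom_span_def mono_def intro: exI[of _ 0] split: if_splits)
           (metis add.right_neutral)
    qed
    show "(monom_span {g + n | g n. g \<in> G} :: 'k mpoly3 set) \<subseteq> ?J"
    proof
      fix f :: "'k mpoly3" assume f: "f \<in> monom_span {g + n | g n. g \<in> G}"
      show "f \<in> ?J"
      proof (induction rule: poly_mapping_single_induct)
        case zero
        show ?case using J.zero_closed by simp
      next
        case (add f g)
        then show ?case using J.a_closed[of f g] by simp
      next
        case (single m)
        then obtain g n where m: "m = g + n" "g \<in> G"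
          using f by (auto simp: monom_span_def)
        have "mono g \<in> ?J" using genideal_self[of "mono ` G"] m by auto
        then have "mono g * Poly_Mapping.single n (Poly_Mapping.lookup f m) \<in> ?J"
          using J.I_r_closed[of "mono g"] by simp
        then show ?case by (simp add: mono_def mult_single m)
      qed
    qed
  qed
qed

definition amaci_monoms :: "nat \<Rightarrow> nat \<Rightarrow> nat \<Rightarrow> nat \<Rightarrow> nat \<Rightarrow> nat \<Rightarrow> monom3 set"
  where "amaci_monoms a b c \<alpha> \<beta> \<gamma> = {m. in_amaci a b c \<alpha> \<beta> \<gamma>
    (Poly_Mapping.lookup m 0) (Poly_Mapping.lookup m 1) (Poly_Mapping.lookup m 2)}"

lemma expo_in_amaci_monoms [simp]:
  "expo i j k \<in> amaci_monoms a b c \<alpha> \<beta> \<gamma> \<longleftrightarrow> in_amaci a b c \<alpha> \<beta> \<gamma> i j k"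
  by (simp add: amaci_monoms_def)

lemma var_eq_single_expo:
  "x_var = Poly_Mapping.single (expo 1 0 0) 1"
  "y_var = Poly_Mapping.single (expo 0 1 0) 1"
  "z_var = Poly_Mapping.single (expo 0 0 1) 1"
  by (simp_all add: x_var_def y_var_def z_var_def mono_def expo_def)

lemma ex_expo_add_iff:
  "(\<exists>n. expo i j k = expo i' j' k' + n) \<longleftrightarrow> i' \<le> i \<and> j' \<le> j \<and> k' \<le> k"
proof
  assume "\<exists>n. expo i j k = expo i' j' k' + n"
  then show "i' \<le> i \<and> j' \<le> j \<and> k' \<le> k" by (auto simp: monom3_eq_iff lookup_add)
next
  assume "i' \<le> i \<and> j' \<le> j \<and> k' \<le> k"
  then have "expo i j k = expo i' j' k' + expo (i - i') (j - j') (k - k')" by simp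
  then show "\<exists>n. expo i j k = expo i' j' k' + n" by blast
qed

lemma amaci_eq_monom_span:
  "amaci a b c \<alpha> \<beta> \<gamma> = (monom_span (amaci_monoms a b c \<alpha> \<beta> \<gamma>) :: 'k::field mpoly3 set)"
proof -
  let ?G = "{expo a 0 0, expo 0 b 0, expo 0 0 c, expo \<alpha> \<beta> \<gamma>}"
  have "amaci a b c \<alpha> \<beta> \<gamma> = (Idl\<^bsub>R_ring\<^esub> (mono ` ?G) :: 'k mpoly3 set)"
    by (simp add: amaci_def var_eq_single_expo single_power mult_single mono_def)
  also have "\<dots> = monom_span {g + n | g n. g \<in> ?G}"
    by (rule genideal_monos)
  also have "{g + n | g n. g \<in> ?G} = amaci_monoms a b c \<alpha> \<beta> \<gamma>"
  proof (rule Set.set_eqI)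
    fix m
    obtain i j k where m: "m = expo i j k" by (cases m)
    have "m \<in> {g + n | g n. g \<in> ?G} \<longleftrightarrow> (\<exists>g\<in>?G. \<exists>n. m = g + n)" by blast
    also have "\<dots> \<longleftrightarrow> m \<in> amaci_monoms a b c \<alpha> \<beta> \<gamma>"
      unfolding m by (simp add: ex_expo_add_iff in_amaci_def)
    finally show "m \<in> {g + n | g n. g \<in> ?G} \<longleftrightarrow> m \<in> amaci_monoms a b c \<alpha> \<beta> \<gamma>" .
  qed
  finally show ?thesis .
qed

lemma ideal_amaci: "ideal (amaci a b c \<alpha> \<beta> \<gamma> :: 'k::field mpoly3 set) R_ring"
  unfolding amaci_def by (intro ring.genideal_ideal ring_R_ring) simp

lemma mono_in_amaci_iff:
  "(mono m :: 'k::field mpoly3) \<in> amaci a b c \<alpha> \<beta> \<gamma> \<longleftrightarrow> m \<in> amaci_monoms a b c \<alpha> \<beta> \<gamma>"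
  by (simp add: amaci_eq_monom_span monom_span_def mono_def)

section \<open>Linear forms in the quotient\<close>

lemma coset_eq_iff:
  assumes "ideal I (R_ring :: 'k::field mpoly3 ring)"
  shows "I +>\<^bsub>R_ring\<^esub> f = I +>\<^bsub>R_ring\<^esub> g \<longleftrightarrow> f - g \<in> I"
proof -
  interpret ideal I "R_ring :: 'k mpoly3 ring" by (rule assms)
  show ?thesis
    using quotient_eq_iff_same_a_r_cos[OF assms, of f g]
    by (simp add: a_minus_def R_ring_a_inv)
qed

lemma coset_mult:
  assumes "ideal I (R_ring :: 'k::field mpoly3 ring)"
  shows "(I +>\<^bsub>R_ring\<^esub> f) \<otimes>\<^bsub>R_ring Quot I\<^esub> (I +>\<^bsub>R_ring\<^esub> g) = I +>\<^bsub>R_ring\<^esub> (f * g)"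
  using ideal.rcoset_mult_add[OF assms, of f g] by (simp add: FactRing_def)

lemma R_comp_mult: "f \<in> R_comp d \<Longrightarrow> g \<in> R_comp e \<Longrightarrow> f * g \<in> R_comp (d + e)"
  using keys_mult[of f g] by (fastforce simp: R_comp_def mdeg_add)

definition linear_form :: "'k::field \<Rightarrow> 'k \<Rightarrow> 'k \<Rightarrow> 'k mpoly3"
  where "linear_form u v w = Poly_Mapping.single (expo 1 0 0) u
    + Poly_Mapping.single (expo 0 1 0) v + Poly_Mapping.single (expo 0 0 1) w"

lemma ex_linear_form:
  assumes "f \<in> R_comp 1"
  obtains u v w where "f = linear_form u v w"
proof
  let ?f = "Poly_Mapping.lookup f"
  show "f = linear_form (?f (expo 1 0 0)) (?f (expo 0 1 0)) (?f (expo 0 0 1))"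
  proof (rule poly_mapping_eqI)
    fix m
    obtain i j k where m: "m = expo i j k" by (cases m)
    have "?f m = 0" if "i + j + k \<noteq> 1"
      using assms that by (force simp: R_comp_def in_keys_iff m)
    moreover have "(i = 1 \<and> j = 0 \<and> k = 0) \<or> (i = 0 \<and> j = 1 \<and> k = 0)
        \<or> (i = 0 \<and> j = 0 \<and> k = 1)" if "i + j + k = 1" 
      using that by linarith
    ultimately show "?f m = Poly_Mapping.lookup
        (linear_form (?f (expo 1 0 0)) (?f (expo 0 1 0)) (?f (expo 0 0 1))) m"
      by (auto simp: linear_form_def lookup_add lookup_single when_def m)
  qed
qed

lemma linear_form_in_R_comp: "linear_form u v w \<in> R_comp 1"
  using keys_add[of "Poly_Mapping.single (expo 1 0 0) u + Poly_Mapping.single (expo 0 1 0) v"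
      "Poly_Mapping.single (expo 0 0 1) w"]
    keys_add[of "Poly_Mapping.single (expo 1 0 0) u" "Poly_Mapping.single (expo 0 1 0) v"]
  by (fastforce simp: R_comp_def linear_form_def split: if_splits)

lemma CHAR_mpoly3: "CHAR('k::field mpoly3) = CHAR('k)"
proof (rule CHAR_eqI)
  fix n :: nat
  assume "of_nat n = (0 :: 'k mpoly3)"
  then have "Poly_Mapping.single 0 (of_nat n :: 'k) = (0 :: 'k mpoly3)" by simp
  then have "of_nat n = (0::'k)" by (metis lookup_single_eq lookup_zero)
  then show "CHAR('k) dvd n" by (simp add: of_nat_eq_0_iff_char_dvd)
qed (metis of_nat_CHAR single_of_nat single_zero)

text \<open>
  Frobenius again, now in three variables: $q$-th powers of linear forms are combinations of
  $x^q, y^q, z^q$.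
\<close>

lemma linear_form_power_in_amaci:
  fixes u v w :: "'k::field"
  assumes "prime CHAR('k)" and q: "q = CHAR('k) ^ m" and "a \<le> q" "b \<le> q" "c \<le> q"
  shows "linear_form u v w ^ q \<in> amaci a b c \<alpha> \<beta> \<gamma>"
proof -
  have q': "q = CHAR('k mpoly3) ^ m" and p': "prime CHAR('k mpoly3)"
    using assms by (simp_all add: CHAR_mpoly3)
  have "linear_form u v w ^ q = Poly_Mapping.single (expo q 0 0) (u ^ q)
      + Poly_Mapping.single (expo 0 q 0) (v ^ q) + Poly_Mapping.single (expo 0 0 q) (w ^ q)"
    unfolding linear_form_def
    by (simp add: freshmans_dream'[OF p' q'] single_power)
  moreover have "Poly_Mapping.single n x \<in> amaci a b c \<alpha> \<beta> \<gamma>"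
    if "n \<in> amaci_monoms a b c \<alpha> \<beta> \<gamma>" for n and x :: 'k
    using that by (simp add: amaci_eq_monom_span monom_span_def)
  moreover have "f + g \<in> amaci a b c \<alpha> \<beta> \<gamma>"
    if "f \<in> amaci a b c \<alpha> \<beta> \<gamma>" "g \<in> amaci a b c \<alpha> \<beta> \<gamma>" for f g :: "'k mpoly3"
    using that keys_add[of f g] by (auto simp: amaci_eq_monom_span monom_span_def)
  ultimately show ?thesis
    using assms by (simp add: in_amaci_def)
qed

section \<open>Multiplication by a linear form is not injective in degree s\<close>

text \<open>
  A monomial outside $I$ all of whose multiples by variables lie in $I$ has exponents
  $(\alpha - 1, b - 1, c - 1)$, $(a - 1, \beta - 1, c - 1)$ or $(a - 1, b - 1, \gamma - 1)$. Its degree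
  is at least $s$: for the first one, $\alpha + b + c = 3(s + 2) - a - (\beta + \gamma)$, where $a \le s + 2$ and
  $\beta + \gamma \le s + 2 - \alpha \le s + 1$.
\<close>

lemma in_amaci_Suc_below_socle:
  assumes total: "a + b + c + \<alpha> + \<beta> + \<gamma> = 3 * (s + 2)"
    and "a \<le> s + 2" "b \<le> s + 2" "c \<le> s + 2" "\<alpha> + \<beta> + \<gamma> \<le> s + 2"
    and "\<alpha> < a" "\<beta> < b" "\<gamma> < c"
    and out: "\<not> in_amaci a b c \<alpha> \<beta> \<gamma> i j k" and low: "i + j + k < s"
  shows "\<not> in_amaci a b c \<alpha> \<beta> \<gamma> (Suc i) j k \<or> \<not> in_amaci a b c \<alpha> \<beta> \<gamma> i (Suc j) k
    \<or> \<not> in_amaci a b c \<alpha> \<beta> \<gamma> i j (Suc k)"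
proof (rule ccontr)
  assume "\<not> ?thesis"
  then have x: "Suc i = a \<or> Suc i = \<alpha> \<and> \<beta> \<le> j \<and> \<gamma> \<le> k"
    and y: "Suc j = b \<or> Suc j = \<beta> \<and> \<alpha> \<le> i \<and> \<gamma> \<le> k"
    and z: "Suc k = c \<or> Suc k = \<gamma> \<and> \<alpha> \<le> i \<and> \<beta> \<le> j"
    using out by (auto simp: in_amaci_def le_Suc_eq)
  have total': "a + b + c + \<alpha> + \<beta> + \<gamma> = 3 * s + 6" using total by simp
  consider "Suc i = a" "Suc j = b" "Suc k = c"
    | "Suc i = \<alpha>" "Suc j = b" "Suc k = c" | "Suc i = a" "Suc j = \<beta>" "Suc k = c"
    | "Suc i = a" "Suc j = b" "Suc k = \<gamma>"
    using x y z by fastforce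
  then show False
  proof cases
    case 1
    \<comment> \<open>here $x^{a-1} y^{b-1} z^{c-1}$ would be a multiple of the mixed monomial\<close>
    then show False using out assms by (auto simp: in_amaci_def)
  next
    case 2
    then show False using total' assms(2-5) low by linarith
  next
    case 3
    then show False using total' assms(2-5) low by linarith
  next
    case 4
    then show False using total' assms(2-5) low by linarith
  qed
qed

lemma lookup_single_mult:
  "Poly_Mapping.lookup (Poly_Mapping.single n (1::'k::field) * f) (n + m)
    = Poly_Mapping.lookup f (m :: monom3)"
proof (induction f rule: poly_mapping_single_induct)
  case (single k)
  show ?case by (simp add: mult_single lookup_single when_def)
qed (simp_all add: distrib_left lookup_add)

text \<open>
  The absence of socle below degree $s$, passed from monomials to polynomials: multiplication by a
  variable shifts the support injectively, so a monomial outside $I$ cannot cancel.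
\<close>

lemma ex_variable_multiple_not_in_amaci:
  fixes f :: "'k::field mpoly3"
  assumes total: "a + b + c + \<alpha> + \<beta> + \<gamma> = 3 * (s + 2)"
    and "a \<le> s + 2" "b \<le> s + 2" "c \<le> s + 2" "\<alpha> + \<beta> + \<gamma> \<le> s + 2"
    and "\<alpha> < a" "\<beta> < b" "\<gamma> < c"
    and f: "f \<in> R_comp (int d)" "f \<notin> amaci a b c \<alpha> \<beta> \<gamma>" and low: "d < s"
  obtains h where "h \<in> R_comp 1" "h * f \<notin> amaci a b c \<alpha> \<beta> \<gamma>"
proof -
  obtain m where m: "m \<in> Poly_Mapping.keys f" "m \<notin> amaci_monoms a b c \<alpha> \<beta> \<gamma>"
    using f(2) by (auto simp: amaci_eq_monom_span monom_span_def)
  obtain i j k where ijk: "m = expo i j k" by (cases m)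
  have "int (mdeg m) = int d"
    using f(1) m(1) unfolding R_comp_def by blast
  then have deg: "i + j + k < s"
    using low by (simp add: ijk)
  consider "\<not> in_amaci a b c \<alpha> \<beta> \<gamma> (Suc i) j k" | "\<not> in_amaci a b c \<alpha> \<beta> \<gamma> i (Suc j) k"
    | "\<not> in_amaci a b c \<alpha> \<beta> \<gamma> i j (Suc k)"
    using in_amaci_Suc_below_socle[OF assms(1-8), of i j k] m(2) deg by (auto simp: ijk)
  then have "\<exists>n. mdeg n = 1 \<and> n + m \<notin> amaci_monoms a b c \<alpha> \<beta> \<gamma>"
  proof cases
    case 1
    then show ?thesis by (intro exI[of _ "expo 1 0 0"]) (simp add: ijk)
  next
    case 2
    then show ?thesis by (intro exI[of _ "expo 0 1 0"]) (simp add: ijk)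
  next
    case 3
    then show ?thesis by (intro exI[of _ "expo 0 0 1"]) (simp add: ijk)
  qed
  then obtain n where n: "mdeg n = 1" "n + m \<notin> amaci_monoms a b c \<alpha> \<beta> \<gamma>" by blast
  have "n + m \<in> Poly_Mapping.keys (Poly_Mapping.single n 1 * f)"
    using m(1) by (simp add: in_keys_iff lookup_single_mult)
  then have "Poly_Mapping.single n 1 * f \<notin> amaci a b c \<alpha> \<beta> \<gamma>"
    using n(2) by (auto simp: amaci_eq_monom_span monom_span_def)
  moreover have "Poly_Mapping.single n (1::'k) \<in> R_comp 1"
    using n(1) by (simp add: R_comp_def)
  ultimately show ?thesis using that by blast
qed

text \<open>
  The last power of $\ell$ outside $I$ lies in degree at most $s$ because $\ell^q \in I$; being killed by
  $\ell$ survives multiplication by variables, which can be chosen to stay outside $I$ until degree $s$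
  is reached.
\<close>

lemma ex_kernel_element:
  fixes u v w :: "'k::field"
  assumes p: "prime CHAR('k)" and q: "q = CHAR('k) ^ m"
    and total: "a + b + c + \<alpha> + \<beta> + \<gamma> = 3 * (s + 2)"
    and le: "a \<le> q" "b \<le> q" "c \<le> q" "q \<le> s + 1"
    and mixed: "\<alpha> + \<beta> + \<gamma> \<le> s + 2" "0 < \<alpha> + \<beta> + \<gamma>"
    and lt: "\<alpha> < a" "\<beta> < b" "\<gamma> < c"
  shows "\<exists>f \<in> R_comp (int s). f \<notin> amaci a b c \<alpha> \<beta> \<gamma> \<and>
    linear_form u v w * f \<in> amaci a b c \<alpha> \<beta> \<gamma>"
proof -
  let ?I = "amaci a b c \<alpha> \<beta> \<gamma> :: 'k mpoly3 set" and ?l = "linear_form u v w"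
  interpret ideal ?I R_ring by (rule ideal_amaci)
  define j where "j = (LEAST j. ?l ^ Suc j \<in> ?I)"
  have "?l ^ q \<in> ?I"
    by (rule linear_form_power_in_amaci[OF p q le(1-3)])
  moreover have "0 < q" using le lt by linarith
  ultimately have "?l ^ Suc (q - 1) \<in> ?I" by simp
  then have j: "?l ^ Suc j \<in> ?I" "j \<le> q - 1"
    unfolding j_def by (rule LeastI) (rule Least_le, fact)
  have "?l ^ j \<notin> ?I"
  proof (cases j)
    case 0
    have "0 \<notin> amaci_monoms a b c \<alpha> \<beta> \<gamma>"
      using lt mixed by (auto simp: in_amaci_def simp flip: expo_0)
    then show ?thesis using 0 by (simp add: amaci_eq_monom_span monom_span_def)
  next
    case (Suc i)
    then show ?thesis
      using not_less_Least[of i "\<lambda>j. ?l ^ Suc j \<in> ?I"] by (simp add: j_def)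
  qed
  moreover have "?l ^ n \<in> R_comp (int n)" for n
  proof (induction n)
    case 0
    show ?case by (simp add: R_comp_def flip: expo_0)
  next
    case (Suc n)
    then show ?case
      using R_comp_mult[OF linear_form_in_R_comp[of u v w] Suc] by simp
  qed
  moreover have "?l * ?l ^ j \<in> ?I" using j by simp
  ultimately have start: "\<exists>f \<in> R_comp (int j). f \<notin> ?I \<and> ?l * f \<in> ?I" by blast
  have "\<exists>f \<in> R_comp (int d). f \<notin> ?I \<and> ?l * f \<in> ?I" if "j \<le> d" "d \<le> s" for d
    using that
  proof (induction d rule: dec_induct)
    case base
    show ?case by (rule start)
  next
    case (step d)
    then obtain f where f: "f \<in> R_comp (int d)" "f \<notin> ?I" "?l * f \<in> ?I" by auto
    obtain h where h: "h \<in> R_comp 1" "h * f \<notin> ?I"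
      using f(1,2) by (rule ex_variable_multiple_not_in_amaci[OF total, rotated 7])
        (use step.prems le mixed lt in auto)
    have "h * (?l * f) \<in> ?I" using I_l_closed[OF f(3), of h] by simp
    then have "?l * (h * f) \<in> ?I" by (simp add: mult.left_commute)
    moreover have "h * f \<in> R_comp (int (Suc d))"
      using R_comp_mult[OF h(1) f(1)] by simp
    ultimately show ?case using h(2) by blast
  qed
  then show ?thesis using j le by simp
qed

section \<open>Failure of the weak Lefschetz property\<close>

text \<open>The linear functional on $[R]_d$ with prescribed values at the monomials.\<close>

definition graded_form :: "nat \<Rightarrow> (nat \<Rightarrow> nat \<Rightarrow> nat \<Rightarrow> 'k::field) \<Rightarrow> 'k mpoly3 \<Rightarrow> 'k"
  where "graded_form d \<phi> f = (\<Sum>m | mdeg m = d. Poly_Mapping.lookup f m *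
    \<phi> (Poly_Mapping.lookup m 0) (Poly_Mapping.lookup m 1) (Poly_Mapping.lookup m 2))"

lemma graded_form_0: "graded_form d \<phi> 0 = 0"
  by (simp add: graded_form_def)

lemma graded_form_add: "graded_form d \<phi> (f + g) = graded_form d \<phi> f + graded_form d \<phi> g"
  by (simp add: graded_form_def lookup_add distrib_right sum.distrib)

lemma graded_form_diff: "graded_form d \<phi> (f - g) = graded_form d \<phi> f - graded_form d \<phi> g"
  by (simp add: graded_form_def lookup_minus left_diff_distrib sum_subtractf)

lemma graded_form_single:
  "graded_form d \<phi> (Poly_Mapping.single (expo i j k) x) = (if i + j + k = d then x * \<phi> i j k else 0)"
proof -
  have "graded_form d \<phi> (Poly_Mapping.single (expo i j k) x) =
      (\<Sum>m | mdeg m = d. if m = expo i j k then x * \<phi> i j k else 0)"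
    unfolding graded_form_def by (intro sum.cong) (auto simp: lookup_single when_def)
  then show ?thesis by (simp add: finite_mdeg_eq)
qed

lemma graded_form_amaci:
  assumes "annihilates (in_amaci a b c \<alpha> \<beta> \<gamma>) s u v w \<phi>" and "f \<in> amaci a b c \<alpha> \<beta> \<gamma>"
  shows "graded_form (s + 1) \<phi> f = 0"
  unfolding graded_form_def
proof (intro sum.neutral ballI)
  fix m assume "m \<in> {m. mdeg m = s + 1}"
  moreover obtain i j k where m: "m = expo i j k" by (cases m)
  ultimately have deg: "i + j + k = s + 1" by simp
  show "Poly_Mapping.lookup f m * \<phi> (Poly_Mapping.lookup m 0) (Poly_Mapping.lookup m 1)
      (Poly_Mapping.lookup m 2) = 0"
  proof (cases "m \<in> Poly_Mapping.keys f")
    case True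
    then have "in_amaci a b c \<alpha> \<beta> \<gamma> i j k"
      using assms(2) m by (auto simp: amaci_eq_monom_span monom_span_def)
    then have "\<phi> i j k = 0" using assms(1) deg unfolding annihilates_def by blast
    then show ?thesis by (simp add: m)
  qed (simp add: in_keys_iff)
qed

lemma graded_form_linear_form_mult:
  assumes "annihilates U s u v w \<phi>" and f: "f \<in> R_comp (int s)"
  shows "graded_form (s + 1) \<phi> (linear_form u v w * f) = 0"
proof (induction f rule: poly_mapping_single_induct)
  case (single m)
  obtain i j k where m: "m = expo i j k" by (cases m)
  have "int (mdeg m) = int s" using f single unfolding R_comp_def by blast
  then have deg: "i + j + k = s" by (simp add: m)
  let ?x = "Poly_Mapping.lookup f m"
  have "graded_form (s + 1) \<phi> (linear_form u v w * Poly_Mapping.single m ?x)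
      = ?x * (u * \<phi> (Suc i) j k + v * \<phi> i (Suc j) k + w * \<phi> i j (Suc k))"
    using deg
    by (simp add: m linear_form_def distrib_right mult_single graded_form_add graded_form_single
        algebra_simps)
  also have "\<dots> = 0" using assms(1) deg by (simp add: annihilates_def)
  finally show ?case .
qed (simp_all add: graded_form_0 graded_form_add distrib_left)

text \<open>
  Both alternatives fail in degree $s$, for every linear form: \<open>ex_kernel_element\<close> refutes
  injectivity, and a functional that kills $I$ and $\ell [R]_s$ but not some monomial of degree $s + 1$
  keeps that monomial out of the image.
\<close>

lemma not_weak_lefschetz_amaci:
  assumes p: "prime CHAR('k::field)" and q: "q = CHAR('k) ^ m"
    and total: "a + b + c + \<alpha> + \<beta> + \<gamma> = 3 * (s + 2)"
    and le: "a \<le> q" "b \<le> q" "c \<le> q" "q \<le> s + 1"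
    and mixed: "\<alpha> + \<beta> + \<gamma> \<le> s + 2" "0 < \<alpha> + \<beta> + \<gamma>"
    and lt: "\<alpha> < a" "\<beta> < b" "\<gamma> < c"
  defines "I \<equiv> amaci a b c \<alpha> \<beta> \<gamma> :: 'k mpoly3 set"
  shows "\<not> weak_lefschetz (R_ring Quot I) (quot_comp I)"
proof
  assume "weak_lefschetz (R_ring Quot I) (quot_comp I)"
  then obtain L where L: "L \<in> quot_comp I 1"
    and wl_all: "\<forall>d. inj_on (\<lambda>Q. L \<otimes>\<^bsub>R_ring Quot I\<^esub> Q) (quot_comp I d) \<or>
      (\<lambda>Q. L \<otimes>\<^bsub>R_ring Quot I\<^esub> Q) ` quot_comp I d = quot_comp I (d + 1)"
    unfolding weak_lefschetz_def by (rule bexE)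
  note wl = spec[OF wl_all, of "int s"]
  have I: "ideal I R_ring" unfolding I_def by (rule ideal_amaci)
  obtain l where l: "l \<in> R_comp 1" "L = I +>\<^bsub>R_ring\<^esub> l"
    using L unfolding quot_comp_def by blast
  obtain u v w where "l = linear_form u v w" using l(1) by (rule ex_linear_form)
  then have mult: "L \<otimes>\<^bsub>R_ring Quot I\<^esub> (I +>\<^bsub>R_ring\<^esub> f) = I +>\<^bsub>R_ring\<^esub> (linear_form u v w * f)" for f
    using coset_mult[OF I] l(2) by simp
  show False
    using wl
  proof
    assume inj: "inj_on (\<lambda>Q. L \<otimes>\<^bsub>R_ring Quot I\<^esub> Q) (quot_comp I (int s))"
    obtain f where f: "f \<in> R_comp (int s)" "f \<notin> I" "linear_form u v w * f \<in> I"
      using ex_kernel_element[OF assms(1-12), of u v w] unfolding I_def by blast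
    have eq: "L \<otimes>\<^bsub>R_ring Quot I\<^esub> (I +>\<^bsub>R_ring\<^esub> f) = L \<otimes>\<^bsub>R_ring Quot I\<^esub> (I +>\<^bsub>R_ring\<^esub> 0)"
      using f(3) by (simp add: mult coset_eq_iff[OF I])
    have mem: "I +>\<^bsub>R_ring\<^esub> f \<in> quot_comp I (int s)" "I +>\<^bsub>R_ring\<^esub> 0 \<in> quot_comp I (int s)"
      using f(1) by (auto simp: quot_comp_def R_comp_def)
    have "I +>\<^bsub>R_ring\<^esub> f = I +>\<^bsub>R_ring\<^esub> 0"
      using inj_onD[OF inj _ mem] eq by simp
    then show False using f(2) by (simp add: coset_eq_iff[OF I])
  next
    assume surj: "(\<lambda>Q. L \<otimes>\<^bsub>R_ring Quot I\<^esub> Q) ` quot_comp I (int s) = quot_comp I (int s + 1)"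
    have pos: "0 < a" "0 < b" "0 < c" using lt by auto
    obtain \<phi> where \<phi>: "annihilates (in_amaci a b c \<alpha> \<beta> \<gamma>) s u v w \<phi>"
      using ex_annihilating_form[OF p q total le pos mixed(1), of u v w] by blast
    obtain i j k where nz: "i + j + k = s + 1" "\<phi> i j k \<noteq> 0"
      using \<phi> unfolding annihilates_def by blast
    \<comment> \<open>\<open>\<phi>\<close> separates this monomial from $I + \ell [R]_s$\<close>
    let ?n = "Poly_Mapping.single (expo i j k) 1 :: 'k mpoly3"
    have "I +>\<^bsub>R_ring\<^esub> ?n \<in> quot_comp I (int s + 1)"
      using nz(1) by (auto simp: quot_comp_def R_comp_def)
    then obtain f where f: "f \<in> R_comp (int s)" "I +>\<^bsub>R_ring\<^esub> ?n = I +>\<^bsub>R_ring\<^esub> (linear_form u v w * f)"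
      unfolding surj[symmetric] by (auto simp: quot_comp_def mult)
    then have "?n - linear_form u v w * f \<in> amaci a b c \<alpha> \<beta> \<gamma>"
      by (simp add: coset_eq_iff[OF I] flip: I_def)
    from graded_form_amaci[OF \<phi> this] have "graded_form (s + 1) \<phi> ?n = 0"
      using graded_form_linear_form_mult[OF \<phi> f(1)] by (simp add: graded_form_diff)
    then show False using nz by (simp add: graded_form_single)
  qed
qed

section \<open>The matrix of multiplication by x + y + z\<close>

lemma mono_dvd_mono_iff: "(mono m :: 'k::field mpoly3) dvd mono n \<longleftrightarrow> (\<exists>k. n = m + k)"
proof
  assume "(mono m :: 'k mpoly3) dvd mono n"
  then obtain f :: "'k mpoly3" where "mono n = mono m * f" by (rule dvdE)
  then have "n \<in> Poly_Mapping.keys (mono m * f)" by (metis keys_single insertI1 mono_def zero_neq_one)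
  then show "\<exists>k. n = m + k" using keys_mult[of "mono m" f] by (auto simp: mono_def)
next
  assume "\<exists>k. n = m + k"
  then obtain k where "n = m + k" by blast
  then have "mono n = (mono m :: 'k mpoly3) * mono k" by (simp add: mono_def mult_single)
  then show "(mono m :: 'k mpoly3) dvd mono n" by (rule dvdI)
qed

lemma expo_dvd_next_degree:
  assumes "mdeg n = Suc (i + j + k)"
  shows "(\<exists>l. n = expo i j k + l) \<longleftrightarrow> n \<in> {expo (Suc i) j k, expo i (Suc j) k, expo i j (Suc k)}"
proof -
  obtain i' j' k' where n: "n = expo i' j' k'" by (cases n)
  show ?thesis using assms unfolding n by (auto simp: ex_expo_add_iff)
qed

lemma std_monoms:
  fixes a b c \<alpha> \<beta> \<gamma> d :: nat
  defines "I \<equiv> amaci a b c \<alpha> \<beta> \<gamma> :: 'k::field mpoly3 set"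
  shows "set (std_monoms I (int d)) = {m. mdeg m = d \<and> m \<notin> amaci_monoms a b c \<alpha> \<beta> \<gamma>}"
    and "distinct (std_monoms I (int d))"
proof -
  have "{m. int (mdeg m) = int d \<and> mono m \<notin> I} = {m. mdeg m = d \<and> m \<notin> amaci_monoms a b c \<alpha> \<beta> \<gamma>}"
    by (simp add: I_def mono_in_amaci_iff)
  moreover have "finite {m. mdeg m = d \<and> m \<notin> amaci_monoms a b c \<alpha> \<beta> \<gamma>}"
    using finite_mdeg_eq[of d] by (rule rev_finite_subset) auto
  ultimately show "set (std_monoms I (int d)) = {m. mdeg m = d \<and> m \<notin> amaci_monoms a b c \<alpha> \<beta> \<gamma>}"
    and "distinct (std_monoms I (int d))"
    by (simp_all add: std_monoms_def)
qed

text \<open>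
  Row $m$ of $Z$ has its ones at those of $xm, ym, zm$ that lie outside $I$. As the functional is $0$ on
  the others, its values at the columns give row sum $\varphi(xm) + \varphi(ym) + \varphi(zm) = 0$.
\<close>

lemma of_int_det_Z_mat_eq_0:
  fixes I :: "'k::field mpoly3 set"
  assumes I: "I = amaci a b c \<alpha> \<beta> \<gamma>"
    and ann: "annihilates (in_amaci a b c \<alpha> \<beta> \<gamma>) s (1::'k) 1 1 \<phi>"
  shows "(of_int (det (Z_mat I (int s))) :: 'k) = 0"
proof -
  define rows cols where "rows = std_monoms I (int s)" and "cols = std_monoms I (int s + 1)"
  have rows: "set rows = {m. mdeg m = s \<and> m \<notin> amaci_monoms a b c \<alpha> \<beta> \<gamma>}"
    using std_monoms(1)[where d = s] unfolding rows_def I by blast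
  have cols: "set cols = {m. mdeg m = s + 1 \<and> m \<notin> amaci_monoms a b c \<alpha> \<beta> \<gamma>}" "distinct cols"
    using std_monoms[where d = "s + 1"] unfolding cols_def I int_plus of_nat_1 by blast+
  let ?Z = "Z_mat I (int s)" and ?r = "length rows" and ?n = "length cols"
  have Z: "?Z = mat ?r ?n (\<lambda>(i, j). if (mono (rows ! i) :: 'k mpoly3) dvd mono (cols ! j) then 1 else 0)"
    unfolding Z_mat_def Let_def rows_def cols_def ..
  show ?thesis
  proof (cases "?r = ?n")
    case False
    \<comment> \<open>\<open>det\<close> is $0$ by definition on a matrix that is not square\<close>
    then show ?thesis by (simp add: det_def Z)
  next
    case True
    let ?\<phi> = "\<lambda>m. \<phi> (Poly_Mapping.lookup m 0) (Poly_Mapping.lookup m 1) (Poly_Mapping.lookup m 2)"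
    let ?K = "map_mat of_int ?Z :: 'k mat" and ?x = "vec ?n (\<lambda>j. ?\<phi> (cols ! j))"
    have K: "?K \<in> carrier_mat ?n ?n" using True by (simp add: Z)
    have zero: "\<phi> i j k = 0" if "i + j + k = s + 1" "expo i j k \<in> amaci_monoms a b c \<alpha> \<beta> \<gamma>" for i j k
      using ann that unfolding annihilates_def by simp
    have "?x \<noteq> 0\<^sub>v ?n"
    proof
      assume x: "?x = 0\<^sub>v ?n"
      obtain i j k where nz: "i + j + k = s + 1" "\<phi> i j k \<noteq> 0"
        using ann unfolding annihilates_def by blast
      then have "expo i j k \<in> set cols"
        using zero[of i j k] by (auto simp: cols(1) simp del: expo_in_amaci_monoms)
      then obtain t where t: "t < ?n" "cols ! t = expo i j k" by (auto simp: in_set_conv_nth)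
      have "?x $ t = 0" using x t(1) by simp
      then show False using t nz by simp
    qed
    moreover have "?K *\<^sub>v ?x = 0\<^sub>v ?n"
    proof (rule eq_vecI)
      fix r assume "r < dim_vec (0\<^sub>v ?n :: 'k vec)"
      then have r: "r < ?n" by simp
      obtain i j k where m: "rows ! r = expo i j k" by (cases "rows ! r")
      have "rows ! r \<in> set rows" using r True by simp
      then have deg: "i + j + k = s" by (simp add: rows m)
      let ?N = "{expo (Suc i) j k, expo i (Suc j) k, expo i j (Suc k)}"
      have dvd: "(mono (expo i j k) :: 'k mpoly3) dvd mono n \<longleftrightarrow> n \<in> ?N" if "n \<in> set cols" for n
        using that deg expo_dvd_next_degree[of n i j k] by (simp add: mono_dvd_mono_iff cols(1))
      have "(?K *\<^sub>v ?x) $ r = (\<Sum>t<?n. (if (mono (expo i j k) :: 'k mpoly3) dvd mono (cols ! t)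
          then 1 else 0) * ?\<phi> (cols ! t))"
        using r True by (simp add: Z scalar_prod_def atLeast0LessThan m if_distrib cong: if_cong)
      also have "\<dots> = (\<Sum>t<?n. if cols ! t \<in> ?N then ?\<phi> (cols ! t) else 0)"
        by (intro sum.cong) (simp_all add: dvd)
      also have "\<dots> = (\<Sum>n\<in>set cols. if n \<in> ?N then ?\<phi> n else 0)"
        using bij_betw_nth[OF cols(2), of "{..<?n}" "set cols"]
        by (intro sum.reindex_bij_betw[where g = "\<lambda>n. if n \<in> ?N then ?\<phi> n else 0"]) simp
      also have "\<dots> = (\<Sum>n\<in>set cols \<inter> ?N. ?\<phi> n)"
        by (rule sum.inter_restrict[symmetric]) simp
      also have "\<dots> = (\<Sum>n\<in>?N. ?\<phi> n)"
      proof (rule sum.mono_neutral_left)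
        show "\<forall>n\<in>?N - set cols \<inter> ?N. ?\<phi> n = 0"
          using deg zero by (auto simp: cols(1) simp del: expo_in_amaci_monoms)
      qed auto
      also have "\<dots> = \<phi> (Suc i) j k + \<phi> i (Suc j) k + \<phi> i j (Suc k)"
        by (simp add: add.assoc)
      also have "\<dots> = 0" using ann deg by (simp add: annihilates_def)
      finally show "(?K *\<^sub>v ?x) $ r = 0\<^sub>v ?n $ r" using r by simp
    qed (use True in \<open>simp add: Z\<close>)
    ultimately have "det ?K = 0"
      using det_0_iff_vec_prod_zero[OF K] by (auto intro!: exI[of _ ?x])
    then show ?thesis by (simp only: of_int_hom.hom_det)
  qed
qed

section \<open>The three consequences\<close>

theorem proposition3p10:
  fixes a b c \<alpha> \<beta> \<gamma> p m :: nat
    and s A B C M :: int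
    and I :: "'k::field mpoly3 set"
  assumes "infinite (UNIV :: 'k set)"
    and "I = amaci a b c \<alpha> \<beta> \<gamma>"
    and "\<alpha> < a" and "\<beta> < b" and "\<gamma> < c"
    and "\<not> (\<alpha> = 0 \<and> \<beta> = 0)" and "\<not> (\<alpha> = 0 \<and> \<gamma> = 0)" and "\<not> (\<beta> = 0 \<and> \<gamma> = 0)"
    and "3 dvd a + b + c + \<alpha> + \<beta> + \<gamma>"
    and "s = int (a + b + c + \<alpha> + \<beta> + \<gamma>) div 3 - 2"
    and "A = s + 2 - int a"
    and "B = s + 2 - int b"
    and "C = s + 2 - int c"
    and "M = s + 2 - int (\<alpha> + \<beta> + \<gamma>)"
    and "0 \<le> M"
    and "0 \<le> A" and "A \<le> int (\<beta> + \<gamma>)"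
    and "0 \<le> B" and "B \<le> int (\<alpha> + \<gamma>)"
    and "0 \<le> C" and "C \<le> int (\<alpha> + \<beta>)"
    and "p = CHAR('k)" and "0 < p"
    and "0 < m"
    and "Max {a, b, c} \<le> p ^ m"
    and "int (p ^ m) \<le> s + 1"
  shows "\<not> weak_lefschetz (R_ring Quot I) (quot_comp I)
    \<and> (prime p \<and> int p dvd det (Z_mat I s))
    \<and> (prime p \<and> int p dvd det (N_mat a b c \<alpha> \<beta> \<gamma>))"
proof -
  let ?q = "p ^ m"
  have p: "prime p" and pK: "prime CHAR('k)"
    using assms(22,23) prime_CHAR_semidom[where ?'a = 'k] by simp_all
  have q: "?q = CHAR('k) ^ m" using assms(22) by simp
  have "0 \<le> s" 
  proof -
    have "2 \<le> p" using p by (rule prime_ge_2_nat)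
    also have "p \<le> ?q" using \<open>0 < m\<close> \<open>0 < p\<close> self_le_power[of p m] by simp
    finally show ?thesis using assms(26) by linarith
  qed
  then obtain S where S: "s = int S" using nonneg_int_cases by blast
  obtain T where T: "a + b + c + \<alpha> + \<beta> + \<gamma> = 3 * T" using assms(9) by (rule dvdE)
  then have "int (a + b + c + \<alpha> + \<beta> + \<gamma>) div 3 = int T" by simp
  then have "T = S + 2" using assms(10) S by linarith
  then have total: "a + b + c + \<alpha> + \<beta> + \<gamma> = 3 * (S + 2)" using T by simp
  have le: "a \<le> ?q" "b \<le> ?q" "c \<le> ?q" "?q \<le> S + 1"
  proof -
    show "?q \<le> S + 1" using assms(26) S by linarith
  qed (use assms(25) in simp_all)
  have pos: "0 < a" "0 < b" "0 < c" "0 < \<alpha> + \<beta> + \<gamma>" using assms(3-6) by auto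
  have mixed: "\<alpha> + \<beta> + \<gamma> \<le> S + 2" using assms(14,15) S by linarith
  have "\<not> weak_lefschetz (R_ring Quot I) (quot_comp I)"
    unfolding assms(2) using not_weak_lefschetz_amaci[OF pK q total le mixed pos(4) assms(3-5)] .
  moreover have "int p dvd det (Z_mat I s)"
  proof -
    obtain \<phi> where "annihilates (in_amaci a b c \<alpha> \<beta> \<gamma>) S (1::'k) 1 1 \<phi>"
      using ex_annihilating_form[OF pK q total le pos(1-3) mixed, of 1 1 1] by blast
    then have "(of_int (det (Z_mat I s)) :: 'k) = 0"
      unfolding S by (rule of_int_det_Z_mat_eq_0[OF assms(2)])
    then show ?thesis unfolding assms(22) by (simp only: of_int_eq_0_iff_char_dvd)
  qed
  moreover have "int p dvd det (N_mat a b c \<alpha> \<beta> \<gamma>)"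
  proof -
    define A' C' M' where "A' = S + 2 - a" and "C' = S + 2 - c" and "M' = S + 2 - (\<alpha> + \<beta> + \<gamma>)"
    have eqs: "A' + a = S + 2" "C' + c = S + 2" "M' + \<alpha> + \<beta> + \<gamma> = S + 2"
      using le mixed by (simp_all add: A'_def C'_def M'_def)
    have "A' + (C' + M') = b" using eqs total by (simp add: algebra_simps)
    then have "det (relation_mat (1::'k) 1 c \<beta> \<gamma> A' C' (C' + M')) = 0"
      using le pos eqs by (intro det_relation_mat_eq_0[OF pK q]) auto
    then have "(of_int (det (N_mat a b c \<alpha> \<beta> \<gamma>)) :: 'k) = 0"
      by (simp only: of_int_N_mat[OF total eqs, symmetric] of_int_hom.hom_det)
    then show ?thesis unfolding assms(22) by (simp only: of_int_eq_0_iff_char_dvd)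
  qed
  ultimately show ?thesis using p by blast
qed

end
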